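(* Let $B_n$ denote the $n$-th Bernoulli number. The sequence $\left\{\frac{|B_{2n}|}{(2n)!}\right\}_{n\geq 1}$ is log-convex; that is, for all integers $n\geq 2$, $$\left(\frac{|B_{2n}|}{(2n)!}\right)^2\leq \frac{|B_{2n-2}|}{(2n-2)!}\cdot\frac{|B_{2n+2}|}{(2n+2)!}.$$
   Context: A sequence $\{a_n\}_{n\geq 1}$ of real numbers is log-convex if $a_n^2\leq a_{n-1}a_{n+1}$ for all $n\geq 2$. The Bernoulli numbers are the usual ones, so that $|B_{2n}|=\frac{2(2n)!}{(2\pi)^{2n}}\zeta(2n)$ for $n\ge 1$, where $\zeta$ is the Riemann zeta function. *)

theory Defs
  imports "HOL-Analysis.Analysis" "HOL-Computational_Algebra.Formal_Power_Series"
begin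

text \<open>
  Bernoulli numbers via the exponential generating function
  \<open>t / (e^t - 1) = (\<Sum>n. B_n t^n / n!)\<close>, so \<open>B_1 = -1/2\<close>.
\<close>

definition bernoulli :: "nat \<Rightarrow> real" where
  "bernoulli n = fact n * fps_nth (fps_X / (fps_exp 1 - 1)) n"

lemma bernoulli_egf:
  "Abs_fps (\<lambda>n. bernoulli n / fact n) * (fps_exp 1 - 1) = fps_X"
proof -
  define E :: "real fps" where "E = fps_exp 1 - 1"
  have ne: "fps_nth E 1 \<noteq> 0" and z: "fps_nth E 0 = 0"
    by (simp_all add: E_def)
  hence sd: "subdegree E = 1"
    by (intro subdegreeI) auto
  have "Abs_fps (\<lambda>n. bernoulli n / fact n) = fps_X / E"
    by (rule fps_ext) (simp add: bernoulli_def E_def)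
  moreover have "E dvd fps_X"
    using sd ne by (subst fps_dvd_iff) auto
  ultimately show ?thesis
    unfolding E_def by simp
qed

text \<open>Sequences are indexed from 1: the value \<open>a 0\<close> is irrelevant.\<close>

definition log_convex :: "(nat \<Rightarrow> real) \<Rightarrow> bool" where
  "log_convex a \<longleftrightarrow> (\<forall>n\<ge>2. (a n)\<^sup>2 \<le> a (n - 1) * a (n + 1))"

end

theory Submission
  imports Defs "HOL-Complex_Analysis.Complex_Analysis"
begin

text \<open>
  Euler's formula \<open>|B_2n| / (2n)! = 2 / (2 \<pi>)^(2n) * (\<Sum>k. 1 / (k + 1)^(2n))\<close> turns the claim into a
  statement about the sums \<open>S j = (\<Sum>k. 1 / (k + 1)^j)\<close>, because the factors \<open>2 / (2 \<pi>)^(2n)\<close> form a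
  geometric progression, for which log-convexity holds with equality. The numbers \<open>S (2n)\<close>
  are the moments of a positive measure on the points \<open>1 / (k + 1)^2\<close>, and moments are log-convex
  by the Cauchy--Schwarz inequality (\<open>reciprocal_power_sum_log_convex\<close>).

  Euler's formula (\<open>abs_bernoulli_even\<close>) comes from two Taylor expansions of one function at 0. With
  \<open>c = 1 / (2 \<pi> \<i>)\<close>, the reflection formula of the Gamma function, differentiated logarithmically,
  expresses the cotangent through the Digamma function; in terms of \<open>t / (e^t - 1)\<close> this says
  \<open>t / (e^t - 1) = 1 + c t (\<psi>(1 - c t) - \<psi>(1 + c t)) - t / 2\<close> near 0
  (\<open>Digamma_mult_exp_minus_one\<close>). The coefficients on the left are \<open>B_n / n!\<close>. Those on the right are
  known because the derivatives of \<open>\<psi>\<close> are the Polygamma functions, whose values at 1 are, up to sign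
  and a factorial, the sums \<open>S j\<close>. Taking the coefficients from derivatives means that no
  double series has to be rearranged.
\<close>

text \<open>
  The power series of the Bernoulli numbers is characterised by its product with \<open>e^t - 1\<close>, since
  formal power series have no zero divisors. This is how the formal, real definition is
  brought to bear on a complex function.
\<close>
lemma bernoulli_fps_nth_complex:
  fixes F :: "complex fps"
  assumes f: "f has_fps_expansion F"
    and eq: "eventually (\<lambda>t. f t * (exp t - 1) = t) (nhds 0)"
  shows "fps_nth F n = of_real (bernoulli n / fact n)"
proof -
  define E :: "complex fps" where "E = fps_exp 1 - 1"
  define L :: "complex fps" where "L = Abs_fps (\<lambda>n. of_real (bernoulli n / fact n))"
  have "(\<lambda>t. f t * (exp t - 1)) has_fps_expansion F * E"
    unfolding E_def by (intro fps_expansion_intros f)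
  hence "(\<lambda>t. t) has_fps_expansion F * E"
    using has_fps_expansion_cong[OF eq refl] by blast
  hence FE: "F * E = fps_X"
    using fps_expansion_unique_complex has_fps_expansion_fps_X by blast
  have LE: "L * E = fps_X"
  proof (rule fps_ext)
    fix n
    have Enth: "fps_nth E k = of_real (fps_nth (fps_exp 1 - 1) k)" for k
      by (simp add: E_def)
    have "fps_nth (L * E) n =
        of_real (fps_nth (Abs_fps (\<lambda>n. bernoulli n / fact n) * (fps_exp 1 - 1)) n)"
      unfolding fps_mult_nth Enth L_def by simp
    thus "fps_nth (L * E) n = fps_nth fps_X n"
      unfolding bernoulli_egf by simp
  qed
  have "fps_nth E 1 \<noteq> 0" by (simp add: E_def)
  hence "E \<noteq> 0" by auto
  with FE LE have "F = L" by (metis mult_right_cancel)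
  thus ?thesis by (simp add: L_def)
qed

text \<open>
  This is the logarithmic derivative of \<open>\<Gamma>(z) \<Gamma>(1 - z) = \<pi> / sin (\<pi> z)\<close>, that is
  \<open>\<psi>(1 - z) - \<psi>(z) = \<pi> cot (\<pi> z)\<close>. Both sides are inverted first: the reciprocals are
  entire, and the formula for them holds on the whole plane and can be differentiated as it stands.
\<close>
lemma Digamma_reflection:
  fixes z :: complex
  assumes z: "z \<notin> \<int>"
  shows "sin (of_real pi * z) * (Digamma (1 - z) - Digamma z) = of_real pi * cos (of_real pi * z)"
proof -
  have z': "1 - z \<notin> \<int>" using z by (metis Ints_1 Ints_diff diff_diff_eq2 add_diff_cancel_left')
  have n: "z \<notin> \<int>\<^sub>\<le>\<^sub>0" "1 - z \<notin> \<int>\<^sub>\<le>\<^sub>0" using z z' nonpos_Ints_Int by blast+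
  have "((\<lambda>z. rGamma z * rGamma (1 - z)) has_field_derivative
      (rGamma z * rGamma (1 - z)) * (Digamma (1 - z) - Digamma z)) (at z)"
    using n by (auto intro!: derivative_eq_intros simp: algebra_simps)
  also have "(\<lambda>z. rGamma z * rGamma (1 - z)) = (\<lambda>z::complex. sin (of_real pi * z) / of_real pi)"
    by (simp add: rGamma_reflection_complex)
  finally have "((\<lambda>z. sin (of_real pi * z) / of_real pi) has_field_derivative
      (sin (of_real pi * z) / of_real pi) * (Digamma (1 - z) - Digamma z)) (at z)"
    unfolding rGamma_reflection_complex .
  moreover have "((\<lambda>z. sin (of_real pi * z) / of_real pi) has_field_derivative
      cos (of_real pi * z)) (at z)"
    by (auto intro!: derivative_eq_intros)
  ultimately show ?thesis
    by (metis DERIV_unique nonzero_divide_eq_eq of_real_eq_0_iff pi_neq_zero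
      times_divide_eq_left mult.commute)
qed

text \<open>
  The scaling \<open>a\<close> serves to use the expansion for both signs of the argument in
  \<open>\<psi>(1 \<plusminus> c t)\<close>.
\<close>
lemma Digamma_shift_has_fps_expansion:
  "(\<lambda>w. Digamma (1 + a * w :: complex)) has_fps_expansion
     Abs_fps (\<lambda>n. a ^ n * (Polygamma n 1 / fact n))"
proof -
  have disj: "ball 1 1 \<inter> \<int>\<^sub>\<le>\<^sub>0 = ({} :: complex set)"
  proof -
    have False if x: "x \<in> ball 1 1" "x \<in> \<int>\<^sub>\<le>\<^sub>0" for x :: complex
    proof -
      obtain k where "x = - of_nat k" using x(2) by (elim nonpos_Ints_cases')
      hence "1 - x = of_nat (Suc k)" by simp
      hence "dist 1 x = real (Suc k)" by (simp only: dist_norm norm_of_nat)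
      with x(1) show False by simp
    qed
    thus ?thesis by blast
  qed
  have "(Digamma \<circ> (\<lambda>w::complex. 1 + w)) holomorphic_on ball 0 1"
    by (rule holomorphic_on_compose_gen[OF _ holomorphic_on_Polygamma[OF disj]])
       (auto intro!: holomorphic_intros)
  hence "(\<lambda>w. Digamma (1 + w :: complex)) holomorphic_on ball 0 1"
    by (simp add: o_def)
  hence "(\<lambda>w. Digamma (1 + w :: complex)) has_fps_expansion
      fps_expansion (\<lambda>w. Digamma (1 + w)) 0"
    by (rule has_fps_expansion_fps_expansion[rotated 2]) auto
  also have "fps_expansion (\<lambda>w. Digamma (1 + w :: complex)) 0 = Abs_fps (\<lambda>n. Polygamma n 1 / fact n)"
    unfolding fps_expansion_def
    using higher_deriv_shift_0[of _ "Digamma :: complex \<Rightarrow> complex" 1]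
    by (simp add: higher_deriv_Polygamma o_def)
  finally have "((\<lambda>w. Digamma (1 + w)) \<circ> (\<lambda>w. a * w)) has_fps_expansion
      fps_compose (Abs_fps (\<lambda>n. Polygamma n 1 / fact n)) (fps_const a * fps_X)"
    by (intro has_fps_expansion_compose fps_expansion_intros) auto
  thus ?thesis by (simp add: o_def fps_compose_linear)
qed

lemma Polygamma_one:
  assumes "n > 0"
  shows "Polygamma n (1::complex) / fact n = (-1) ^ Suc n * of_real (\<Sum>k. 1 / real (Suc k) ^ Suc n)"
proof -
  have "Polygamma n (of_real 1 :: complex) = of_real (Polygamma n 1)"
    by (rule Polygamma_of_real) simp
  thus ?thesis using assms by (simp add: Polygamma_def inverse_eq_divide)
qed

text \<open>
  For \<open>z = t / (2 \<pi> \<i>)\<close> the function \<open>\<pi> z cot (\<pi> z)\<close> is \<open>(t / 2) coth (t / 2)\<close>, which differs from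
  \<open>t / (e^t - 1)\<close> by \<open>t / 2\<close>. The shift from \<open>\<psi>(z)\<close> to \<open>\<psi>(1 + z)\<close> removes the pole at 0 and accounts
  for the summand 1.
\<close>
lemma Digamma_mult_exp_minus_one:
  fixes t :: complex
  assumes "norm t < 1"
  defines "c \<equiv> 1 / (2 * of_real pi * \<i>)"
  shows "(1 + c * t * (Digamma (1 - c * t) - Digamma (1 + c * t)) - t / 2) * (exp t - 1) = t"
proof (cases "t = 0")
  case False
  define z where "z = c * t"
  have "norm c < 1" using pi_gt3 by (simp add: c_def norm_divide norm_mult field_simps)
  have z0: "z \<noteq> 0" using False by (simp add: z_def c_def)
  have "norm z < 1"
    using mult_strict_mono[OF \<open>norm c < 1\<close> assms(1)] by (simp add: z_def norm_mult)
  have "z \<notin> \<int>"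
  proof
    assume "z \<in> \<int>"
    then obtain k where "z = of_int k" by (elim Ints_cases)
    with \<open>norm z < 1\<close> z0 show False by simp
  qed
  define s where "s = sin (of_real pi * z)"
  define C where "C = cos (of_real pi * z)"
  define D where "D = Digamma (1 - z) - Digamma (1 + z)"
  have "s * (Digamma (1 - z) - Digamma z) = of_real pi * C"
    unfolding s_def C_def by (rule Digamma_reflection) fact
  moreover have "Digamma z = Digamma (1 + z) - 1 / z"
    using Digamma_plus1[OF z0] by (simp add: add.commute)
  ultimately have "s * (D + 1 / z) = of_real pi * C"
    by (simp add: D_def algebra_simps)
  hence A: "s * (1 + z * D) = of_real pi * z * C"
    using z0 by (simp add: field_simps)
  have pz: "\<i> * (of_real pi * z) = t / 2" by (simp add: z_def c_def)
  \<comment> \<open>\<open>s\<close>, \<open>C\<close> and \<open>exp t\<close> are all rational in \<open>u\<close>, which makes the rest algebra\<close>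
  define u where "u = exp (t / 2)"
  have u0: "u \<noteq> 0" by (simp add: u_def)
  have e: "exp t = u * u" by (simp add: u_def flip: exp_add)
  have s: "u - inverse u = 2 * \<i> * s"
    unfolding s_def sin_exp_eq pz u_def by (simp add: pz exp_minus)
  have C: "u + inverse u = 2 * C"
    unfolding C_def cos_exp_eq pz u_def by (simp add: pz exp_minus)
  have t: "t = 2 * \<i> * of_real pi * z" using pz by (simp add: mult_ac)
  have "(1 + z * D) * (u - inverse u) = 2 * \<i> * (s * (1 + z * D))" by (simp add: s)
  also have "\<dots> = t / 2 * (u + inverse u)" unfolding A C t by simp
  finally have B: "(1 + z * D) * (u - inverse u) = t / 2 * (u + inverse u)" .
  have "(1 + z * D - t / 2) * (exp t - 1) = u * ((1 + z * D - t / 2) * (u - inverse u))"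
    using u0 by (simp add: e algebra_simps)
  also have "\<dots> = u * ((1 + z * D) * (u - inverse u) - t / 2 * (u - inverse u))"
    by (simp add: algebra_simps)
  also have "(1 + z * D) * (u - inverse u) - t / 2 * (u - inverse u) = t * inverse u"
  proof -
    have "t / 2 * (u + v) - t / 2 * (u - v) = t * v" for v
      by (simp add: field_simps)
    thus ?thesis unfolding B .
  qed
  also have "u * (t * inverse u) = t" using u0 by simp
  finally show ?thesis by (simp add: D_def z_def mult.assoc)
qed auto

lemma summable_reciprocal_powers:
  assumes "j \<ge> 2"
  shows "summable (\<lambda>k. 1 / real (Suc k) ^ j)"
  using summable_Suc_iff[of "\<lambda>k. 1 / real k ^ j"] inverse_power_summable[OF assms, where 'a=real]
  by (simp add: inverse_eq_divide)

text \<open>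
  Euler's formula for the values of the zeta function at the even positive integers. Of the two
  Digamma expansions the even coefficients cancel and the odd ones double; the factor \<open>t\<close> moves
  them to even exponents. What remains is \<open>-2 c^(2n)\<close> times the sum with
  \<open>c = 1 / (2 \<pi> \<i>)\<close>, so the sign \<open>(-1)^(n+1)\<close> disappears on taking norms.
\<close>
theorem abs_bernoulli_even:
  assumes "n > 0"
  shows "\<bar>bernoulli (2 * n)\<bar> / fact (2 * n) =
     2 / (2 * pi) ^ (2 * n) * (\<Sum>k. 1 / real (Suc k) ^ (2 * n))"
proof -
  define c :: complex where "c = 1 / (2 * of_real pi * \<i>)"
  define P where "P = (\<lambda>n. Polygamma n (1::complex) / fact n)"
  define F where "F = 1 + fps_const c * fps_X *
    (Abs_fps (\<lambda>n. (-c) ^ n * P n) - Abs_fps (\<lambda>n. c ^ n * P n)) - fps_const (1/2) * fps_X"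
  define S where "S = (\<Sum>k. 1 / real (Suc k) ^ (2 * n))"
  have "(\<lambda>t. 1 + c * t * (Digamma (1 + (-c) * t) - Digamma (1 + c * t)) - 1 / 2 * t) has_fps_expansion F"
    unfolding F_def P_def
    by (intro fps_expansion_intros Digamma_shift_has_fps_expansion)
  moreover have "eventually (\<lambda>t::complex. t \<in> ball 0 1) (nhds 0)"
    by (intro eventually_nhds_in_open) auto
  hence "eventually (\<lambda>t.
      (1 + c * t * (Digamma (1 + (-c) * t) - Digamma (1 + c * t)) - 1 / 2 * t) * (exp t - 1) = t) (nhds 0)"
    by eventually_elim (use Digamma_mult_exp_minus_one in \<open>simp add: c_def\<close>)
  ultimately have "fps_nth F (2 * n) = of_real (bernoulli (2 * n) / fact (2 * n))"
    by (rule bernoulli_fps_nth_complex)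
  moreover obtain m where m: "n = Suc m" using assms by (cases n) auto
  have "fps_nth F (2 * n) = - 2 * c ^ (2 * n) * P (2 * n - 1)"
    unfolding F_def by (simp add: m mult.assoc algebra_simps)
  moreover have "P (2 * n - 1) = of_real S"
    unfolding P_def S_def using assms by (subst Polygamma_one) (auto simp: m)
  ultimately have "norm (complex_of_real (bernoulli (2 * n) / fact (2 * n))) = norm (- 2 * c ^ (2 * n) * of_real S)"
    by metis
  moreover have "S \<ge> 0"
    unfolding S_def using assms by (intro suminf_nonneg summable_reciprocal_powers) auto
  ultimately show ?thesis
    by (simp add: norm_mult norm_power norm_divide c_def S_def power_divide)
qed

text \<open>
  With \<open>x = 1 / (k + 1)\<close>, the sum of the nonnegative terms \<open>x^p * (1 - l x^2)^2\<close> is the quadratic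
  polynomial \<open>S p - 2 l S (p + 2) + l^2 S (p + 4)\<close> in \<open>l\<close>. Its nonnegativity at its minimum is the claim.
\<close>
lemma reciprocal_power_sum_log_convex:
  fixes p :: nat
  assumes "p \<ge> 2"
  defines "S \<equiv> (\<lambda>j. \<Sum>k. 1 / real (Suc k) ^ j)"
  shows "(S (p + 2))\<^sup>2 \<le> S p * S (p + 4)"
proof -
  have pos: "S (p + 4) > 0"
    unfolding S_def by (intro suminf_pos summable_reciprocal_powers) (use assms in auto)
  \<comment> \<open>the minimum point of the quadratic polynomial\<close>
  define l where "l = S (p + 2) / S (p + 4)"
  have sums: "(\<lambda>k. 1 / real (Suc k) ^ p - 2 * l * (1 / real (Suc k) ^ (p + 2)) + l\<^sup>2 * (1 / real (Suc k) ^ (p + 4)))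
      sums (S p - 2 * l * S (p + 2) + l\<^sup>2 * S (p + 4))"
    unfolding S_def by (intro sums_add sums_diff sums_mult summable_sums
         summable_reciprocal_powers) (use assms in auto)
  have "0 \<le> S p - 2 * l * S (p + 2) + l\<^sup>2 * S (p + 4)"
  proof (rule sums_le[OF _ sums_zero sums])
    fix k :: nat
    define x where "x = 1 / real (Suc k)"
    have "1 / real (Suc k) ^ p - 2 * l * (1 / real (Suc k) ^ (p + 2)) + l\<^sup>2 * (1 / real (Suc k) ^ (p + 4))
       = x ^ p - 2 * l * x ^ (p + 2) + l\<^sup>2 * x ^ (p + 4)" by (simp add: x_def power_one_over)
    also have "\<dots> = x ^ p * (1 - l * x\<^sup>2)\<^sup>2"
      by (simp add: algebra_simps power2_eq_square power_add eval_nat_numeral)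
    finally show "0 \<le> 1 / real (Suc k) ^ p - 2 * l * (1 / real (Suc k) ^ (p + 2)) + l\<^sup>2 * (1 / real (Suc k) ^ (p + 4))"
      by (simp add: x_def)
  qed
  also have "\<dots> = S p - (S (p + 2))\<^sup>2 / S (p + 4)"
    using pos by (simp add: l_def field_simps power2_eq_square)
  finally show ?thesis using pos by (simp add: field_simps)
qed

theorem theorem2p2:
  shows "log_convex (\<lambda>n. \<bar>bernoulli (2 * n)\<bar> / fact (2 * n)) \<and>
    (\<forall>n::nat. n \<ge> 2 \<longrightarrow>
      (\<bar>bernoulli (2 * n)\<bar> / fact (2 * n))\<^sup>2
        \<le> (\<bar>bernoulli (2 * n - 2)\<bar> / fact (2 * n - 2)) * (\<bar>bernoulli (2 * n + 2)\<bar> / fact (2 * n + 2)))"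
proof -
  define b where "b = (\<lambda>n. \<bar>bernoulli (2 * n)\<bar> / fact (2 * n))"
  define S where "S = (\<lambda>j. \<Sum>k. 1 / real (Suc k) ^ j)"
  have b: "b n = 2 / (2 * pi) ^ (2 * n) * S (2 * n)" if "n > 0" for n
    unfolding b_def S_def by (rule abs_bernoulli_even) fact
  have step: "(b n)\<^sup>2 \<le> b (n - 1) * b (n + 1)" if n2: "n \<ge> 2" for n
  proof -
    obtain m where n: "n = Suc m" "m \<ge> 1" using n2 by (cases n) auto
    have idx: "n - 1 = m" "n + 1 = Suc (Suc m)" "2 * Suc m = 2 * m + 2"
        "2 * Suc (Suc m) = 2 * m + 4"
      using n by simp_all
    have bm: "b m = 2 / (2 * pi) ^ (2 * m) * S (2 * m)"
        "b (Suc m) = 2 / (2 * pi) ^ (2 * m + 2) * S (2 * m + 2)"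
        "b (Suc (Suc m)) = 2 / (2 * pi) ^ (2 * m + 4) * S (2 * m + 4)"
      using b[of m] b[of "Suc m"] b[of "Suc (Suc m)"] n(2) unfolding idx by linarith+
    define q where "q = (\<lambda>j. 2 / (2 * pi) ^ j)"
    have geom: "(q (2 * m + 2))\<^sup>2 = q (2 * m) * q (2 * m + 4)"
      by (simp add: q_def power2_eq_square power_add eval_nat_numeral)
    have "(b n)\<^sup>2 = (q (2 * m + 2))\<^sup>2 * (S (2 * m + 2))\<^sup>2"
      unfolding n(1) bm(2) q_def by (rule power_mult_distrib)
    also have "\<dots> \<le> (q (2 * m + 2))\<^sup>2 * (S (2 * m) * S (2 * m + 4))"
      unfolding S_def
      by (intro mult_left_mono reciprocal_power_sum_log_convex) (use n in auto)
    also have "\<dots> = b (n - 1) * b (n + 1)"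
      unfolding geom idx(1,2) bm(1,3) by (simp only: q_def mult_ac)
    finally show ?thesis .
  qed
  have "(b n)\<^sup>2 \<le> (\<bar>bernoulli (2 * n - 2)\<bar> / fact (2 * n - 2)) * (\<bar>bernoulli (2 * n + 2)\<bar> / fact (2 * n + 2))"
    if "n \<ge> 2" for n
    using step[OF that] by (simp add: b_def diff_mult_distrib2)
  with step show ?thesis
    unfolding log_convex_def b_def by blast
qed

end
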